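(* Let $G=(V,E)$ be an infinite connected graph. The following two conditions are equivalent. (i) There is a strictly positive metrizable weight $w:E\to[0,\infty)$ such that no $\rho\in\mathfrak M_w$ is a metric. (ii) There are two distinct vertices $u^*,v^*\in V$ and a sequence of paths $F_j$, $j\in\mathbb N$, each joining $u^*$ and $v^*$, such that the upper limit $\limsup_{j\to\infty}V(F_j)$ is an independent set.
   Context: Graphs are simple; paths are finite. A weight $w$ is strictly positive if $w(e)>0$ for all $e\in E$, and metrizable if there is a pseudometric $d$ on $V$ with $d(u,v)=w(\{u,v\})$ for all $\{u,v\}\in E$. $\mathfrak M_w$ is the set of all pseudometrics $\rho$ on $V$ with $\rho(u,v)=w(\{u,v\})$ for all $\{u,v\}\in E$; a metric is a pseudometric with $\rho(x,y)=0\Rightarrow x=y$. For sets $A_n$, $\limsup_{n\to\infty}A_n=\bigcap_{k\ge1}\bigcup_{n\ge1}A_{n+k}$ is the set of elements belonging to $A_n$ for infinitely many $n$. A set of vertices is independent if no two of its vertices are adjacent. *)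

theory Defs
  imports Complex_Main "HOL-Library.Infinite_Set" "HOL-Library.Liminf_Limsup"
begin

definition simple_graph :: "'a set \<Rightarrow> 'a set set \<Rightarrow> bool" where
  "simple_graph V E \<longleftrightarrow> (\<forall>e\<in>E. \<exists>u\<in>V. \<exists>v\<in>V. u \<noteq> v \<and> e = {u, v})"

text \<open>A (finite) path is given by the list of its pairwise distinct vertices in the order of
  traversal, so the vertex set of a path \<open>p\<close> is \<open>set p\<close>.\<close>

definition graph_path :: "'a set \<Rightarrow> 'a set set \<Rightarrow> 'a list \<Rightarrow> bool" where
  "graph_path V E p \<longleftrightarrow>
     p \<noteq> [] \<and> set p \<subseteq> V \<and> distinct p \<and> successively (\<lambda>x y. {x, y} \<in> E) p"

definition joins :: "'a list \<Rightarrow> 'a \<Rightarrow> 'a \<Rightarrow> bool" where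
  "joins p u v \<longleftrightarrow> p \<noteq> [] \<and> hd p = u \<and> last p = v"

definition connected_graph :: "'a set \<Rightarrow> 'a set set \<Rightarrow> bool" where
  "connected_graph V E \<longleftrightarrow> (\<forall>u\<in>V. \<forall>v\<in>V. \<exists>p. graph_path V E p \<and> joins p u v)"

definition independent_vertices :: "'a set \<Rightarrow> 'a set set \<Rightarrow> 'a set \<Rightarrow> bool" where
  "independent_vertices V E A \<longleftrightarrow> A \<subseteq> V \<and> (\<forall>x\<in>A. \<forall>y\<in>A. {x, y} \<notin> E)"

text \<open>Functions on \<open>V \<times> V\<close> and on \<open>E\<close> are represented by total functions; only their values
  on \<open>V \<times> V\<close> and \<open>E\<close>, respectively, matter.\<close>

definition pseudometric_on :: "'a set \<Rightarrow> ('a \<Rightarrow> 'a \<Rightarrow> real) \<Rightarrow> bool" where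
  "pseudometric_on V d \<longleftrightarrow>
     (\<forall>x\<in>V. \<forall>y\<in>V. 0 \<le> d x y) \<and>
     (\<forall>x\<in>V. d x x = 0) \<and>
     (\<forall>x\<in>V. \<forall>y\<in>V. d x y = d y x) \<and>
     (\<forall>x\<in>V. \<forall>y\<in>V. \<forall>z\<in>V. d x z \<le> d x y + d y z)"

definition metric_on :: "'a set \<Rightarrow> ('a \<Rightarrow> 'a \<Rightarrow> real) \<Rightarrow> bool" where
  "metric_on V d \<longleftrightarrow>
     pseudometric_on V d \<and> (\<forall>x\<in>V. \<forall>y\<in>V. d x y = 0 \<longrightarrow> x = y)"

definition weight :: "'a set set \<Rightarrow> ('a set \<Rightarrow> real) \<Rightarrow> bool" where
  "weight E w \<longleftrightarrow> (\<forall>e\<in>E. 0 \<le> w e)"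

definition strictly_positive :: "'a set set \<Rightarrow> ('a set \<Rightarrow> real) \<Rightarrow> bool" where
  "strictly_positive E w \<longleftrightarrow> (\<forall>e\<in>E. 0 < w e)"

definition weight_pseudometrics ::
    "'a set \<Rightarrow> 'a set set \<Rightarrow> ('a set \<Rightarrow> real) \<Rightarrow> ('a \<Rightarrow> 'a \<Rightarrow> real) set" where
  "weight_pseudometrics V E w =
     {\<rho>. pseudometric_on V \<rho> \<and> (\<forall>u v. {u, v} \<in> E \<longrightarrow> \<rho> u v = w {u, v})}"

definition metrizable :: "'a set \<Rightarrow> 'a set set \<Rightarrow> ('a set \<Rightarrow> real) \<Rightarrow> bool" where
  "metrizable V E w \<longleftrightarrow>
     (\<exists>d. pseudometric_on V d \<and> (\<forall>u v. {u, v} \<in> E \<longrightarrow> d u v = w {u, v}))"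

text \<open>The upper limit of a sequence of sets is the library's \<^const>\<open>limsup\<close> in the complete
  lattice of sets.\<close>

lemma limsup_set_eq:
  fixes A :: "nat \<Rightarrow> 'a set"
  shows "limsup A = (\<Inter>k\<in>{1..}. \<Union>n\<in>{1..}. A (n + k))"
proof -
  have "limsup A = (\<Inter>n. \<Union>m\<in>{n..}. A m)"
    by (rule limsup_INF_SUP)
  also have "\<dots> = (\<Inter>k\<in>{1..}. \<Union>n\<in>{1..}. A (n + k))"
  proof (intro equalityI INT_I subsetI)
    fix x k assume "x \<in> (\<Inter>n. \<Union>m\<in>{n..}. A m)"
    then obtain m where "m \<ge> Suc k" "x \<in> A m" by blast
    moreover from this have "m = (m - k) + k" "m - k \<ge> 1" by auto
    ultimately show "x \<in> (\<Union>n\<in>{1..}. A (n + k))"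
      by (metis UN_I atLeast_iff)
  next
    fix x n assume "x \<in> (\<Inter>k\<in>{1..}. \<Union>n\<in>{1..}. A (n + k))"
    then have "x \<in> (\<Union>i\<in>{1..}. A (i + Suc n))"
      by (metis INT_E atLeast_iff le_add1 plus_1_eq_Suc)
    then obtain i where "x \<in> A (i + Suc n)" by blast
    then show "x \<in> (\<Union>m\<in>{n..}. A m)"
      by (intro UN_I[of "i + Suc n"]) auto
  qed
  finally show ?thesis .
qed

lemma mem_limsup_set_iff:
  fixes A :: "nat \<Rightarrow> 'a set"
  shows "x \<in> limsup A \<longleftrightarrow> infinite {n. x \<in> A n}"
  by (auto simp: limsup_INF_SUP infinite_nat_iff_unbounded_le)

end

theory Submission imports Defs begin

text \<open>If \<open>w\<close> is metrizable, the infimum of walk lengths is the largest element of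
  \<open>weight_pseudometrics V E w\<close>. If it is not a metric, it vanishes at some \<open>u \<noteq> v\<close>, so \<open>u\<close> and \<open>v\<close>
  are joined by paths whose lengths tend to \<open>0\<close>; every vertex lying on infinitely many of them has
  distance \<open>0\<close> from \<open>u\<close>, and two such vertices cannot span an edge of positive weight.

  Conversely, let \<open>A\<close> be the upper limit. A vertex \<open>x \<notin> A\<close> lies on no \<open>F j\<close> with \<open>j > N x\<close>. Put
  \<open>f x = 0\<close> on \<open>A\<close> and \<open>f x = 1 / ((n + 1) (\<Sum>i\<le>n. length (F i)))\<close> with \<open>n = N x\<close> elsewhere. The
  distance \<open>d x y = f x + f y\<close> for \<open>x \<noteq> y\<close> is a pseudometric, positive on edges because \<open>A\<close> is
  independent, and \<open>F j\<close> has length at most \<open>2 / (j + 1)\<close>.\<close>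

section \<open>Walks and their lengths\<close>

fun walk_length :: "('a set \<Rightarrow> real) \<Rightarrow> 'a list \<Rightarrow> real" where
  "walk_length w (x # y # p) = w {x, y} + walk_length w (y # p)"
| "walk_length w _ = 0"

text \<open>Vertices may repeat, so that walks, unlike paths, are closed under concatenation; the
  triangle inequality for \<open>walk_dist\<close> rests on this.\<close>

definition walk :: "'a set \<Rightarrow> 'a set set \<Rightarrow> 'a list \<Rightarrow> 'a \<Rightarrow> 'a \<Rightarrow> bool" where
  "walk V E p u v \<longleftrightarrow> joins p u v \<and> set p \<subseteq> V \<and> successively (\<lambda>x y. {x, y} \<in> E) p"

text \<open>The infimum is taken in the reals, so it is meaningful only if a walk exists and the
  lengths are bounded below; connectedness and nonnegative weights provide this.\<close>

definition walk_dist :: "'a set \<Rightarrow> 'a set set \<Rightarrow> ('a set \<Rightarrow> real) \<Rightarrow> 'a \<Rightarrow> 'a \<Rightarrow> real" where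
  "walk_dist V E w u v = (INF p\<in>{p. walk V E p u v}. walk_length w p)"

lemma graph_path_iff_walk:
  "graph_path V E p \<and> joins p u v \<longleftrightarrow> walk V E p u v \<and> distinct p"
  by (auto simp: graph_path_def walk_def joins_def)

lemma walk_length_append:
  "walk_length w (p @ x # q) = walk_length w (p @ [x]) + walk_length w (x # q)"
  by (induction w p rule: walk_length.induct) simp_all

lemma walk_length_rev: "walk_length w (rev p) = walk_length w p"
proof (induction w p rule: walk_length.induct)
  case (1 w x y p)
  then show ?case
    using walk_length_append[of w "rev p" y "[x]"] by (simp add: insert_commute)
qed simp_all

lemma walk_length_nonneg:
  assumes "weight E w" "successively (\<lambda>x y. {x, y} \<in> E) p"
  shows "0 \<le> walk_length w p"
  using assms by (induction w p rule: walk_length.induct) (auto simp: weight_def)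

text \<open>The number of vertices is a coarse count of the edges, chosen to cancel against
  \<open>length (F j)\<close> in the bound on \<open>f\<close>.\<close>

lemma walk_length_le_edge_bound:
  assumes "\<And>x y. x \<in> set p \<Longrightarrow> y \<in> set p \<Longrightarrow> {x, y} \<in> E \<Longrightarrow> w {x, y} \<le> b"
    and "successively (\<lambda>x y. {x, y} \<in> E) p" and "0 \<le> b"
  shows "walk_length w p \<le> real (length p) * b"
  using assms
proof (induction w p rule: walk_length.induct)
  case (1 w x y p)
  have "walk_length w (y # p) \<le> real (length (y # p)) * b"
    using 1 by simp
  moreover have "w {x, y} \<le> b"
    using 1 by simp
  ultimately show ?case
    by (simp add: algebra_simps)
qed simp_all

lemma pseudometric_on_triangle:
  "pseudometric_on V d \<Longrightarrow> x \<in> V \<Longrightarrow> y \<in> V \<Longrightarrow> z \<in> V \<Longrightarrow> d x z \<le> d x y + d y z"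
  unfolding pseudometric_on_def by blast

lemma pseudometric_on_sym:
  "pseudometric_on V d \<Longrightarrow> x \<in> V \<Longrightarrow> y \<in> V \<Longrightarrow> d x y = d y x"
  unfolding pseudometric_on_def by blast

text \<open>The triangle inequality, iterated along the walk. It serves both directions: it bounds
  \<open>walk_dist\<close> below on edges, and it forces \<open>\<rho> u v\<close> to be small along
  short paths.\<close>

lemma dist_le_walk_length:
  assumes "\<rho> \<in> weight_pseudometrics V E w" "walk V E p u v"
  shows "\<rho> u v \<le> walk_length w p"
  using assms(2)
proof (induction p arbitrary: u rule: induct_list012)
  case 1
  then show ?case by (simp add: walk_def joins_def)
next
  case (2 x)
  then show ?case
    using assms(1) by (auto simp: walk_def joins_def weight_pseudometrics_def pseudometric_on_def)
next
  case (3 x y p)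
  have "last (y # p) \<in> set (y # p)"
    by (rule last_in_set) simp
  with 3 have V: "u \<in> V" "y \<in> V" "v \<in> V" and e: "{u, y} \<in> E" and "walk V E (y # p) y v"
    and u: "u = x"
    by (auto simp: walk_def joins_def simp del: last_in_set)
  then have "\<rho> y v \<le> walk_length w (y # p)"
    using 3 by blast
  moreover have "\<rho> u v \<le> \<rho> u y + \<rho> y v"
    using assms(1) V by (intro pseudometric_on_triangle) (auto simp: weight_pseudometrics_def)
  moreover have "\<rho> u y = w {u, y}"
    using assms(1) e by (simp add: weight_pseudometrics_def)
  ultimately show ?case
    using u by simp
qed

lemma walk_rev: "walk V E p u v \<Longrightarrow> walk V E (rev p) v u"
  by (auto simp: walk_def joins_def hd_rev last_rev insert_commute)

lemma walk_trans:
  assumes "walk V E p x y" "walk V E q y z"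
  obtains r where "walk V E r x z" "walk_length w r = walk_length w p + walk_length w q"
proof -
  obtain p' where p: "p = p' @ [y]"
    using assms(1) by (metis walk_def joins_def append_butlast_last_id)
  obtain q' where q: "q = y # q'"
    using assms(2) by (metis walk_def joins_def list.collapse)
  show ?thesis
  proof
    show "walk V E (p' @ y # q') x z"
      using assms unfolding p q
      by (auto simp: walk_def joins_def hd_append successively_append_iff)
    show "walk_length w (p' @ y # q') = walk_length w p + walk_length w q"
      unfolding p q by (rule walk_length_append)
  qed
qed

text \<open>Stopping at \<open>x\<close> drops only edges of nonnegative weight. Hence a short walk
  from \<open>u\<close> keeps all its vertices close to \<open>u\<close>.\<close>

lemma walk_take_until:
  assumes "walk V E p u v" "x \<in> set p" "weight E w"
  obtains q where "walk V E q u x" "walk_length w q \<le> walk_length w p"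
proof -
  obtain a b where p: "p = a @ x # b"
    using assms(2) by (meson split_list)
  show ?thesis
  proof
    show "walk V E (a @ [x]) u x"
      using assms(1) unfolding p
      by (auto simp: walk_def joins_def hd_append successively_append_iff)
    have "successively (\<lambda>x y. {x, y} \<in> E) (x # b)"
      using assms(1) unfolding p by (auto simp: walk_def successively_append_iff)
    then show "walk_length w (a @ [x]) \<le> walk_length w p"
      using walk_length_nonneg[OF assms(3)] unfolding p by (subst (2) walk_length_append) simp
  qed
qed

text \<open>Cutting out the closed walk between two visits to the same vertex does not increase the
  length. This passes from the walks in the infimum to the paths required for
  \<open>F\<close>.\<close>

lemma walk_imp_shorter_path:
  assumes "walk V E p u v" "weight E w"
  shows "\<exists>q. walk V E q u v \<and> distinct q \<and> walk_length w q \<le> walk_length w p"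
  using assms(1)
proof (induction p rule: length_induct)
  case (1 p)
  show ?case
  proof (cases "distinct p")
    case True
    then show ?thesis using 1 by blast
  next
    case False
    then obtain a y b c where p: "p = a @ [y] @ b @ [y] @ c"
      using not_distinct_decomp by blast
    have "successively (\<lambda>x y. {x, y} \<in> E) (a @ (y # b) @ y # c)"
      using "1.prems" unfolding p by (simp add: walk_def)
    then have "successively (\<lambda>x y. {x, y} \<in> E) (a @ y # c)"
      unfolding successively_append_iff by simp
    then have "walk V E (a @ y # c) u v"
      using "1.prems" unfolding p by (auto simp: walk_def joins_def hd_append split: if_splits)
    moreover have "walk_length w (a @ y # c) \<le> walk_length w p"
    proof -
      have "walk_length w p = walk_length w (a @ [y]) + walk_length w (y # b @ [y]) + walk_length w (y # c)"
        using walk_length_append[of w a y "b @ y # c"] walk_length_append[of w "y # b" y c]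
        unfolding p by simp
      moreover have "successively (\<lambda>x y. {x, y} \<in> E) (y # b @ [y])"
        using "1.prems" unfolding p
        by (auto simp: walk_def successively_append_iff successively_Cons hd_append)
      then have "0 \<le> walk_length w (y # b @ [y])"
        using walk_length_nonneg assms(2) by blast
      ultimately show ?thesis
        using walk_length_append[of w a y c] by simp
    qed
    moreover have "length (a @ y # c) < length p"
      unfolding p by simp
    ultimately show ?thesis
      using "1.IH" by (meson order_trans)
  qed
qed

section \<open>The walk distance as a member of \<open>weight_pseudometrics\<close>\<close>

lemma walk_dist_le:
  assumes "weight E w" "walk V E p u v"
  shows "walk_dist V E w u v \<le> walk_length w p"
  unfolding walk_dist_def using assms
  by (intro cINF_lower bdd_belowI[of _ 0]) (auto simp: walk_def walk_length_nonneg)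

lemma connected_graph_walk:
  assumes "connected_graph V E" "u \<in> V" "v \<in> V"
  obtains p where "walk V E p u v"
  using assms graph_path_iff_walk unfolding connected_graph_def by metis

lemma walk_dist_greatest:
  assumes "connected_graph V E" "u \<in> V" "v \<in> V"
    and "\<And>p. walk V E p u v \<Longrightarrow> b \<le> walk_length w p"
  shows "b \<le> walk_dist V E w u v"
  unfolding walk_dist_def using assms(4) connected_graph_walk[OF assms(1-3)]
  by (intro cINF_greatest) auto

lemma walk_dist_pseudometric:
  assumes conn: "connected_graph V E" and w: "weight E w"
  shows "pseudometric_on V (walk_dist V E w)"
proof -
  note le = walk_dist_le[OF w] and ge = walk_dist_greatest[OF conn]
  have nonneg: "0 \<le> walk_dist V E w x y" if "x \<in> V" "y \<in> V" for x y
    using that w by (intro ge) (auto simp: walk_def walk_length_nonneg)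
  have refl: "walk_dist V E w x x = 0" if "x \<in> V" for x
    using le[of V "[x]" x x] nonneg[OF that that] that by (simp add: walk_def joins_def)
  have sym: "walk_dist V E w x y \<le> walk_dist V E w y x" if "x \<in> V" "y \<in> V" for x y
    using that le[OF walk_rev] by (intro ge) (simp_all add: walk_length_rev)
  have tri: "walk_dist V E w x z \<le> walk_dist V E w x y + walk_dist V E w y z"
    if V: "x \<in> V" "y \<in> V" "z \<in> V" for x y z
  proof -
    \<comment> \<open>The two infima are taken one after the other: first over \<open>q\<close> with
      \<open>p\<close> fixed, then over \<open>p\<close>.\<close>
    have "walk_dist V E w x z - walk_length w p \<le> walk_dist V E w y z"
      if p: "walk V E p x y" for p
    proof (rule ge[OF V(2,3)])
      fix q assume "walk V E q y z"
      with p obtain r where "walk V E r x z" "walk_length w r = walk_length w p + walk_length w q"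
        by (rule walk_trans)
      then show "walk_dist V E w x z - walk_length w p \<le> walk_length w q"
        using le[of V r x z] by simp
    qed
    then have "walk_dist V E w x z - walk_dist V E w y z \<le> walk_dist V E w x y"
      by (intro ge[OF V(1,2)]) (simp add: algebra_simps)
    then show ?thesis by simp
  qed
  show ?thesis
    unfolding pseudometric_on_def using nonneg refl sym tri by (auto intro: antisym)
qed

text \<open>An edge is itself a walk, which gives one inequality. No walk between its ends is
  shorter, because any pseudometric \<open>d\<close> witnessing metrizability lies below all walk
  lengths.\<close>

lemma walk_dist_in_weight_pseudometrics:
  assumes "simple_graph V E" "connected_graph V E" "weight E w" "metrizable V E w"
  shows "walk_dist V E w \<in> weight_pseudometrics V E w"
proof -
  obtain d where d: "d \<in> weight_pseudometrics V E w"
    using assms(4) by (auto simp: metrizable_def weight_pseudometrics_def)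
  have "walk_dist V E w u v = w {u, v}" if e: "{u, v} \<in> E" for u v
  proof (rule antisym)
    have V: "u \<in> V" "v \<in> V"
      using e assms(1) by (auto simp: simple_graph_def doubleton_eq_iff)
    show "walk_dist V E w u v \<le> w {u, v}"
      using walk_dist_le[OF assms(3), of V "[u, v]" u v] V e by (simp add: walk_def joins_def)
    have "d u v \<le> walk_dist V E w u v"
      using dist_le_walk_length[OF d] V by (intro walk_dist_greatest[OF assms(2)])
    then show "w {u, v} \<le> walk_dist V E w u v"
      using d e by (simp add: weight_pseudometrics_def)
  qed
  then show ?thesis
    using walk_dist_pseudometric[OF assms(2,3)] by (simp add: weight_pseudometrics_def)
qed

section \<open>From a vanishing distance to a sequence of paths\<close>

lemma zero_walk_dist_imp_paths:
  assumes simple: "simple_graph V E" and conn: "connected_graph V E"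
    and w: "weight E w" and pos: "strictly_positive E w" and met: "metrizable V E w"
    and uv: "u \<in> V" "v \<in> V" and zero: "walk_dist V E w u v = 0"
  shows "\<exists>F :: nat \<Rightarrow> 'a list. (\<forall>j. graph_path V E (F j) \<and> joins (F j) u v) \<and>
    independent_vertices V E (limsup (\<lambda>j. set (F j)))"
proof -
  let ?d = "walk_dist V E w"
  have d: "?d \<in> weight_pseudometrics V E w"
    by (rule walk_dist_in_weight_pseudometrics) fact+
  have "\<exists>p. walk V E p u v \<and> distinct p \<and> walk_length w p < inverse (real (Suc j))" for j
  proof -
    \<comment> \<open>Otherwise \<open>inverse (real (Suc j))\<close> would be a positive lower
      bound of lengths whose infimum is 0.\<close>
    have "\<exists>p. walk V E p u v \<and> walk_length w p < inverse (real (Suc j))"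
      using walk_dist_greatest[OF conn uv, of "inverse (real (Suc j))" w] zero
      by (fastforce simp: not_less)
    then show ?thesis
      using walk_imp_shorter_path[OF _ w] by (meson le_less_trans)
  qed
  then obtain F where F: "walk V E (F j) u v" "distinct (F j)"
    and short: "walk_length w (F j) < inverse (real (Suc j))" for j
    by metis
  have lim: "x \<in> V \<and> ?d u x = 0" if "x \<in> limsup (\<lambda>j. set (F j))" for x
  proof
    have inf: "infinite {j. x \<in> set (F j)}"
      using that by (simp add: mem_limsup_set_iff)
    then obtain j where "x \<in> set (F j)"
      using not_finite_existsD by auto
    then show V: "x \<in> V"
      using F(1)[of j] by (auto simp: walk_def)
    have "?d u x \<le> e" if "0 < e" for e
    proof -
      obtain n where n: "inverse (real (Suc n)) < e"
        using reals_Archimedean[OF \<open>0 < e\<close>] by blast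
      \<comment> \<open>As \<open>x\<close> lies on infinitely many \<open>F j\<close>, one of them
        comes late enough to be shorter than \<open>e\<close>.\<close>
      obtain j where j: "n \<le> j" "x \<in> set (F j)"
        using inf by (auto simp: infinite_nat_iff_unbounded_le)
      obtain q where "walk V E q u x" "walk_length w q \<le> walk_length w (F j)"
        using walk_take_until[OF F(1) j(2) w] .
      then have "?d u x \<le> inverse (real (Suc j))"
        using walk_dist_le[OF w] short[of j] by fastforce
      also have "\<dots> \<le> inverse (real (Suc n))"
        using j(1) by (intro le_imp_inverse_le) simp_all
      finally show ?thesis using n by simp
    qed
    then have "?d u x \<le> 0"
      by (rule field_le_epsilon) simp
    moreover have "0 \<le> ?d u x"
      using d uv V by (simp add: weight_pseudometrics_def pseudometric_on_def)
    ultimately show "?d u x = 0" by simp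
  qed
  have "{x, y} \<notin> E" if "x \<in> limsup (\<lambda>j. set (F j))" "y \<in> limsup (\<lambda>j. set (F j))" for x y
  proof
    assume e: "{x, y} \<in> E"
    have pm: "pseudometric_on V ?d"
      using d by (simp add: weight_pseudometrics_def)
    have "?d x y \<le> ?d u x + ?d u y"
      using pseudometric_on_triangle[OF pm, of x u y] pseudometric_on_sym[OF pm, of x u]
        uv(1) lim[OF that(1)] lim[OF that(2)] by simp
    moreover have "0 < ?d x y"
      using d e pos by (simp add: weight_pseudometrics_def strictly_positive_def)
    ultimately show False
      using lim[OF that(1)] lim[OF that(2)] by simp
  qed
  then show ?thesis
    using F lim
    by (intro exI[of _ F]) (auto simp: graph_path_iff_walk independent_vertices_def)
qed

section \<open>From a sequence of paths to a weight\<close>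

text \<open>This is the distance between leaves of a star whose spoke to \<open>x\<close> has length
  \<open>f x\<close>; spokes of length 0 are allowed.\<close>

lemma pseudometric_on_vertex_sum:
  assumes "\<And>x. 0 \<le> f x"
  shows "pseudometric_on V (\<lambda>x y. if x = y then 0 else f x + f y)"
  unfolding pseudometric_on_def
proof (intro conjI ballI)
  fix x y z
  show "(if x = z then 0 else f x + f z) \<le>
      (if x = y then 0 else f x + f y) + (if y = z then 0 else f y + f z)"
    using assms[of x] assms[of y] assms[of z] by simp
qed (use assms in simp_all)

text \<open>A vertex outside the upper limit meets only finitely many \<open>F j\<close>, so one
  positive value satisfies all the bounds imposed on it.\<close>

lemma ex_vanishing_vertex_function:
  fixes F :: "nat \<Rightarrow> 'a list"
  assumes "\<And>j. F j \<noteq> []"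
  obtains f :: "'a \<Rightarrow> real" where "\<And>x. 0 \<le> f x"
    and "\<And>x. x \<notin> limsup (\<lambda>j. set (F j)) \<Longrightarrow> 0 < f x"
    and "\<And>x j. x \<in> set (F j) \<Longrightarrow> f x \<le> 1 / (real (Suc j) * real (length (F j)))"
proof -
  let ?A = "limsup (\<lambda>j. set (F j))"
  \<comment> \<open>The membership condition stands inside the existential so that the choice
    function \<open>N\<close> is total; its values on \<open>?A\<close> are arbitrary.\<close>
  have "\<forall>x. \<exists>n. x \<notin> ?A \<longrightarrow> (\<forall>j. x \<in> set (F j) \<longrightarrow> j \<le> n)"
    by (auto simp: mem_limsup_set_iff finite_nat_set_iff_bounded_le)
  then obtain N where N: "x \<notin> ?A \<Longrightarrow> x \<in> set (F j) \<Longrightarrow> j \<le> N x" for x j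
    by metis
  \<comment> \<open>The sum dominates the length of every path with index at most
    \<open>n\<close>.\<close>
  define L where "L n = (\<Sum>i\<le>n. length (F i))" for n
  have L: "length (F j) \<le> L n" if "j \<le> n" for j n
    unfolding L_def using that by (intro member_le_sum) auto
  have pos: "0 < length (F j)" for j
    using assms by simp
  \<comment> \<open>A zero denominator would give \<open>f x = 0\<close>, since division by zero
    yields 0.\<close>
  have Lpos: "0 < L n" for n
    using L[of n n] pos[of n] by linarith
  define f where "f x = (if x \<in> ?A then 0 else 1 / (real (Suc (N x)) * real (L (N x))))" for x
  show ?thesis
  proof
    show "0 \<le> f x" for x
      by (simp add: f_def)
    show "0 < f x" if "x \<notin> ?A" for x
      using that Lpos[of "N x"] by (simp add: f_def)
    show "f x \<le> 1 / (real (Suc j) * real (length (F j)))" if x: "x \<in> set (F j)" for x j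
    proof (cases "x \<in> ?A")
      case False
      have "real (Suc j) * real (length (F j)) \<le> real (Suc (N x)) * real (L (N x))"
        using N[OF False x] L[OF N[OF False x]] by (intro mult_mono) simp_all
      moreover have "0 < real (Suc j) * real (length (F j))"
        using pos[of j] by simp
      ultimately show ?thesis
        unfolding f_def using False by (simp only: if_False) (intro divide_left_mono, auto)
    qed (simp add: f_def)
  qed
qed

text \<open>The star distance only witnesses metrizability. The bound on \<open>\<rho> u v\<close>
  uses edge values alone, so it holds for every member of
  \<open>weight_pseudometrics V E w\<close>.\<close>

lemma paths_imp_no_metric:
  fixes F :: "nat \<Rightarrow> 'a list"
  assumes simple: "simple_graph V E" and uv: "u \<in> V" "v \<in> V" "u \<noteq> v"
    and F: "\<And>j. graph_path V E (F j)" "\<And>j. joins (F j) u v"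
    and ind: "independent_vertices V E (limsup (\<lambda>j. set (F j)))"
  shows "\<exists>w. weight E w \<and> strictly_positive E w \<and> metrizable V E w \<and>
    \<not> (\<exists>\<rho> \<in> weight_pseudometrics V E w. metric_on V \<rho>)"
proof -
  have ne: "F j \<noteq> []" for j
    using F(1) by (simp add: graph_path_def)
  obtain f :: "'a \<Rightarrow> real" where f: "\<And>x. 0 \<le> f x"
    and fpos: "\<And>x. x \<notin> limsup (\<lambda>j. set (F j)) \<Longrightarrow> 0 < f x"
    and fle: "\<And>x j. x \<in> set (F j) \<Longrightarrow> f x \<le> 1 / (real (Suc j) * real (length (F j)))"
    using ex_vanishing_vertex_function[of F] ne by blast
  \<comment> \<open>Summing over the edge as a set needs no choice of endpoint order; it gives
    \<open>f x + f y\<close> because the ends of an edge differ.\<close>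
  define w where "w e = sum f e" for e
  have neq: "x \<noteq> y" if "{x, y} \<in> E" for x y
    using that simple by (auto simp: simple_graph_def doubleton_eq_iff)
  have w_edge: "w {x, y} = f x + f y" if "{x, y} \<in> E" for x y
    using neq[OF that] by (simp add: w_def)
  have pos: "0 < w e" if "e \<in> E" for e
  proof -
    obtain x y where e: "e = {x, y}"
      using simple \<open>e \<in> E\<close> unfolding simple_graph_def by blast
    then have "x \<notin> limsup (\<lambda>j. set (F j)) \<or> y \<notin> limsup (\<lambda>j. set (F j))"
      using ind \<open>e \<in> E\<close> unfolding independent_vertices_def by auto
    then have "0 < f x \<or> 0 < f y"
      using fpos by auto
    then show ?thesis
      using f[of x] f[of y] w_edge[of x y] e \<open>e \<in> E\<close> by auto
  qed
  have "metrizable V E w"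
    unfolding metrizable_def using pseudometric_on_vertex_sum[OF f, where V = V] neq w_edge
    by (intro exI[of _ "\<lambda>x y. if x = y then 0 else f x + f y"]) auto
  moreover have "\<not> metric_on V \<rho>" if \<rho>: "\<rho> \<in> weight_pseudometrics V E w" for \<rho>
  proof
    assume met: "metric_on V \<rho>"
    have bound: "\<rho> u v \<le> 2 * inverse (real (Suc j))" for j
    proof -
      let ?c = "1 / (real (Suc j) * real (length (F j)))"
      have "walk V E (F j) u v"
        using F graph_path_iff_walk by metis
      then have "\<rho> u v \<le> walk_length w (F j)"
        by (rule dist_le_walk_length[OF \<rho>])
      also have "\<dots> \<le> real (length (F j)) * (2 * ?c)"
      proof (rule walk_length_le_edge_bound)
        show "w {x, y} \<le> 2 * ?c" if "x \<in> set (F j)" "y \<in> set (F j)" "{x, y} \<in> E" for x y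
          using fle[OF that(1)] fle[OF that(2)] w_edge[OF that(3)] by linarith
      qed (use F(1) in \<open>simp_all add: graph_path_def\<close>)
      also have "\<dots> = 2 * inverse (real (Suc j))"
        using ne[of j] by (simp add: divide_simps)
      finally show ?thesis .
    qed
    have "(\<lambda>j. 2 * inverse (real (Suc j))) \<longlonglongrightarrow> 0"
      using tendsto_mult_right_zero[OF LIMSEQ_inverse_real_of_nat] .
    then have "\<rho> u v \<le> 0"
      by (rule LIMSEQ_le_const) (use bound in blast)
    with met uv show False
      unfolding metric_on_def pseudometric_on_def by (metis antisym)
  qed
  ultimately show ?thesis
    using pos by (intro exI[of _ w]) (auto simp: weight_def strictly_positive_def less_imp_le)
qed

theorem theorem3p7:
  fixes V :: "'a set" and E :: "'a set set"
  assumes "simple_graph V E" and "connected_graph V E" and "infinite V"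
  shows
    "(\<exists>w :: 'a set \<Rightarrow> real.
        weight E w \<and> strictly_positive E w \<and> metrizable V E w \<and>
        \<not> (\<exists>\<rho> \<in> weight_pseudometrics V E w. metric_on V \<rho>))
     \<longleftrightarrow>
     (\<exists>u \<in> V. \<exists>v \<in> V. u \<noteq> v \<and>
        (\<exists>F :: nat \<Rightarrow> 'a list.
           (\<forall>j. graph_path V E (F j) \<and> joins (F j) u v) \<and>
           independent_vertices V E (limsup (\<lambda>j. set (F j)))))"
proof
  assume "\<exists>w. weight E w \<and> strictly_positive E w \<and> metrizable V E w \<and>
    \<not> (\<exists>\<rho> \<in> weight_pseudometrics V E w. metric_on V \<rho>)"
  then obtain w where w: "weight E w" "strictly_positive E w" "metrizable V E w"
    and none: "\<And>\<rho>. \<rho> \<in> weight_pseudometrics V E w \<Longrightarrow> \<not> metric_on V \<rho>"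
    by blast
  \<comment> \<open>The assumption is applied to this single member: not being a metric, it vanishes
    at two distinct vertices.\<close>
  have d: "walk_dist V E w \<in> weight_pseudometrics V E w"
    using walk_dist_in_weight_pseudometrics assms(1,2) w(1,3) .
  then obtain u v where uv: "u \<in> V" "v \<in> V" "walk_dist V E w u v = 0" "u \<noteq> v"
    using none[OF d] by (auto simp: metric_on_def weight_pseudometrics_def)
  show "\<exists>u \<in> V. \<exists>v \<in> V. u \<noteq> v \<and> (\<exists>F :: nat \<Rightarrow> 'a list.
      (\<forall>j. graph_path V E (F j) \<and> joins (F j) u v) \<and>
      independent_vertices V E (limsup (\<lambda>j. set (F j))))"
    using zero_walk_dist_imp_paths[OF assms(1,2) w uv(1-3)] uv by blast
next
  assume "\<exists>u \<in> V. \<exists>v \<in> V. u \<noteq> v \<and> (\<exists>F :: nat \<Rightarrow> 'a list.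
      (\<forall>j. graph_path V E (F j) \<and> joins (F j) u v) \<and>
      independent_vertices V E (limsup (\<lambda>j. set (F j))))"
  then show "\<exists>w. weight E w \<and> strictly_positive E w \<and> metrizable V E w \<and>
    \<not> (\<exists>\<rho> \<in> weight_pseudometrics V E w. metric_on V \<rho>)"
    using paths_imp_no_metric[OF assms(1)] by blast
qed

end
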